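(* Let $Y_0, B_0, \alpha, \beta, \gamma$ be any positive integers and let $p \in (0,1]$. Let $(Y_n, B_n)_{n\ge 0}$ be the two-colour urn process started from $(Y_0,B_0)$ in which, at each step, one ball is drawn uniformly at random from the urn and put back, and then, independently of the past and of the colour drawn, with probability $p$ one adds $\alpha$ balls of the drawn colour and $\beta$ balls of the opposite colour, and with probability $1-p$ one adds $\gamma$ balls of the drawn colour and none of the opposite colour. Let $X_n = Y_n/(Y_n+B_n)$. Then $X_n \longrightarrow \frac12$ almost surely as $n\to\infty$.
   Context: The urn contains $Y_n$ yellow balls and $B_n$ blue balls at time $n$; $X_n = Y_n/(Y_n+B_n)$ is the proportion of yellow balls. Formally, on a probability space $(\Omega,\mathfrak{F},\mathbb{P})$ let $\mathfrak{F}_n$ be the natural filtration, $\mathfrak{F}_n=\sigma\big((Y_k,B_k): 0\le k\le n\big)$. For $n\ge 1$ there are $\{0,1\}$-valued random variables $\zeta_n$ ($\zeta_n=1$ if the $n$-th ball drawn is yellow, $\zeta_n=0$ if it is blue) and $\xi_n$ ($\xi_n=1$ if Friedman's scheme is used at step $n$, $\xi_n=0$ if Pólya's scheme is used) such that $$\mathbb{P}(\zeta_n=1\mid\mathfrak{F}_{n-1}) = 1-\mathbb{P}(\zeta_n=0\mid\mathfrak{F}_{n-1}) = X_{n-1},\qquad \mathbb{P}(\xi_n=1)=1-\mathbb{P}(\xi_n=0)=p,$$ with $\xi_n$ independent of $(\mathfrak{F}_{n-1},\zeta_n)$, so that, for instance, $\mathbb{P}(\xi_n=1,\zeta_n=1\mid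 \mathfrak{F}_{n-1}) = pX_{n-1}$. The urn evolves by $$Y_n = Y_{n-1} + \alpha\,\mathbf{1}_{\{\xi_n=1,\ \zeta_n=1\}} + \beta\,\mathbf{1}_{\{\xi_n=1,\ \zeta_n=0\}} + \gamma\,\mathbf{1}_{\{\xi_n=0,\ \zeta_n=1\}},$$ $$B_n = B_{n-1} + \alpha\,\mathbf{1}_{\{\xi_n=1,\ \zeta_n=0\}} + \beta\,\mathbf{1}_{\{\xi_n=1,\ \zeta_n=1\}} + \gamma\,\mathbf{1}_{\{\xi_n=0,\ \zeta_n=0\}}.$$ The initial values $Y_0,B_0$ are deterministic. *)

theory Defs
  imports "HOL-Probability.Probability"
begin

definition natural_filtration ::
  "'a measure \<Rightarrow> (nat \<Rightarrow> 'a \<Rightarrow> nat) \<Rightarrow> (nat \<Rightarrow> 'a \<Rightarrow> nat) \<Rightarrow> nat \<Rightarrow> 'a measure"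
  where "natural_filtration M Y B n =
    sigma (space M)
      (\<Union>k\<in>{..n}. sets (vimage_algebra (space M) (\<lambda>\<omega>. (Y k \<omega>, B k \<omega>)) (count_space UNIV)))"

definition proportion ::
  "(nat \<Rightarrow> 'a \<Rightarrow> nat) \<Rightarrow> (nat \<Rightarrow> 'a \<Rightarrow> nat) \<Rightarrow> nat \<Rightarrow> 'a \<Rightarrow> real"
  where "proportion Y B n \<omega> = real (Y n \<omega>) / real (Y n \<omega> + B n \<omega>)"

(* zeta n is the indicator that the n-th drawn ball is yellow, xi n the indicator that the
   Friedman scheme (rather than the Polya scheme) is used at step n.  Steps are numbered
   from 1, so the values of both at index 0 are unconstrained and play no role. *)
locale friedman_polya_urn = prob_space M
  for M :: "'a measure" +
  fixes y0 b0 \<alpha> \<beta> \<gamma> :: nat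
    and p :: real
    and Y B \<zeta> \<xi> :: "nat \<Rightarrow> 'a \<Rightarrow> nat"
  assumes zeta_rv: "\<And>n. \<zeta> (Suc n) \<in> M \<rightarrow>\<^sub>M count_space {0, 1}"
    and xi_rv: "\<And>n. \<xi> (Suc n) \<in> M \<rightarrow>\<^sub>M count_space {0, 1}"
    and Y_init: "\<And>\<omega>. \<omega> \<in> space M \<Longrightarrow> Y 0 \<omega> = y0"
    and B_init: "\<And>\<omega>. \<omega> \<in> space M \<Longrightarrow> B 0 \<omega> = b0"
    and Y_step: "\<And>n \<omega>. \<omega> \<in> space M \<Longrightarrow>
      Y (Suc n) \<omega> = Y n \<omega>
        + \<alpha> * of_bool (\<xi> (Suc n) \<omega> = 1 \<and> \<zeta> (Suc n) \<omega> = 1)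
        + \<beta> * of_bool (\<xi> (Suc n) \<omega> = 1 \<and> \<zeta> (Suc n) \<omega> = 0)
        + \<gamma> * of_bool (\<xi> (Suc n) \<omega> = 0 \<and> \<zeta> (Suc n) \<omega> = 1)"
    and B_step: "\<And>n \<omega>. \<omega> \<in> space M \<Longrightarrow>
      B (Suc n) \<omega> = B n \<omega>
        + \<alpha> * of_bool (\<xi> (Suc n) \<omega> = 1 \<and> \<zeta> (Suc n) \<omega> = 0)
        + \<beta> * of_bool (\<xi> (Suc n) \<omega> = 1 \<and> \<zeta> (Suc n) \<omega> = 1)
        + \<gamma> * of_bool (\<xi> (Suc n) \<omega> = 0 \<and> \<zeta> (Suc n) \<omega> = 0)"
    and zeta_yellow: "\<And>n. AE \<omega> in M.
      real_cond_exp M (natural_filtration M Y B n)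
        (indicator {\<omega> \<in> space M. \<zeta> (Suc n) \<omega> = 1}) \<omega> = proportion Y B n \<omega>"
    and zeta_blue: "\<And>n. AE \<omega> in M.
      1 - real_cond_exp M (natural_filtration M Y B n)
        (indicator {\<omega> \<in> space M. \<zeta> (Suc n) \<omega> = 0}) \<omega> = proportion Y B n \<omega>"
    and xi_Friedman: "\<And>n. prob {\<omega> \<in> space M. \<xi> (Suc n) \<omega> = 1} = p"
    and xi_Polya: "\<And>n. 1 - prob {\<omega> \<in> space M. \<xi> (Suc n) \<omega> = 0} = p"
    and xi_indep: "\<And>n. indep_set
      (sets (vimage_algebra (space M) (\<xi> (Suc n)) (count_space {0, 1})))
      (sets (sigma (space M)
        (sets (natural_filtration M Y B n)
          \<union> sets (vimage_algebra (space M) (\<zeta> (Suc n)) (count_space {0, 1})))))"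

end

(* Let w = (Y - B) / (Y + B), so that X = (1 + w) / 2. A Polya step does not change the mean of w,
   a Friedman step contracts it by the factor 1 - 2 beta / (Y + B + alpha + beta), and the total
   Y + B grows linearly. Hence E w(n+1)^2 <= E w(n)^2 - c E w(n)^2 / (n+1) + d / (n+1)^2 with
   c > 0, and telescoping gives that the sum of E w(n)^2 / (n+1) is finite. So almost surely the
   sum of w(n)^2 / (n+1) is finite. Since |w(n+1) - w(n)| = O(1 / (n+1)), the increments of w^3
   are then absolutely summable, so w converges, and the divergence of the harmonic series forces
   the limit to be 0. *)
theory Submission
  imports Defs
begin

section \<open>Two auxiliary facts: a deterministic convergence criterion and a product rule for
  expectations\<close>

text \<open>The cube is the power whose increments the hypotheses control: a^3 - b^3 is a - b times
  a quadratic form, hence at most C / (n+1) times a multiple of a^2 + b^2. Increments of w^2 would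
  only give terms of order |w| / (n+1), about whose sum nothing is known.\<close>

lemma tendsto_zero_if_summable_square_over_Suc:
  fixes w :: "nat \<Rightarrow> real"
  assumes incr: "\<And>n. \<bar>w (Suc n) - w n\<bar> \<le> C / real (Suc n)"
    and summ: "summable (\<lambda>n. (w n)\<^sup>2 / real (Suc n))"
  shows "w \<longlonglongrightarrow> 0"
proof -
  have "C \<ge> 0"
    using incr[of 0] by simp
  \<comment> \<open>Both endpoints of an increment enter the bound on the cubes. Shifting
    \<open>summ\<close> gives the denominator n + 2 instead of n + 1, which costs a factor of at
    most 2.\<close>
  have summ': "summable (\<lambda>n. (w (Suc n))\<^sup>2 / real (Suc n))"
  proof (rule summable_comparison_test')
    show "summable (\<lambda>n. 2 * ((w (Suc n))\<^sup>2 / real (Suc (Suc n))))"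
      using summ by (subst (asm) summable_Suc_iff[symmetric]) (rule summable_mult)
    show "norm ((w (Suc n))\<^sup>2 / real (Suc n)) \<le> 2 * ((w (Suc n))\<^sup>2 / real (Suc (Suc n)))" for n
    proof -
      have "1 / real (Suc n) \<le> 2 / real (Suc (Suc n))"
        by (simp add: field_simps)
      from mult_left_mono[OF this, of "(w (Suc n))\<^sup>2"] show ?thesis
        by (simp add: mult.commute)
    qed
  qed
  have "summable (\<lambda>n. w (Suc n) ^ 3 - w n ^ 3)"
  proof (rule summable_comparison_test')
    show "summable (\<lambda>n. 2 * C * ((w n)\<^sup>2 / real (Suc n) + (w (Suc n))\<^sup>2 / real (Suc n)))"
      by (intro summable_mult summable_add summ summ')
    show "norm (w (Suc n) ^ 3 - w n ^ 3)
      \<le> 2 * C * ((w n)\<^sup>2 / real (Suc n) + (w (Suc n))\<^sup>2 / real (Suc n))" for n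
    proof -
      define a b where "a = w (Suc n)" and "b = w n"
      have "a ^ 3 - b ^ 3 = (a - b) * (a\<^sup>2 + a * b + b\<^sup>2)"
        by (simp add: power2_eq_square power3_eq_cube algebra_simps)
      moreover have "\<bar>a\<^sup>2 + a * b + b\<^sup>2\<bar> \<le> 2 * (a\<^sup>2 + b\<^sup>2)"
      proof -
        have "0 \<le> (a + b)\<^sup>2" "0 \<le> (a - b)\<^sup>2" "0 \<le> a\<^sup>2" "0 \<le> b\<^sup>2"
          by simp_all
        then show ?thesis
          by (simp add: power2_sum power2_diff abs_le_iff)
      qed
      ultimately have "\<bar>a ^ 3 - b ^ 3\<bar> \<le> C / real (Suc n) * (2 * (a\<^sup>2 + b\<^sup>2))"
        using incr[of n] \<open>C \<ge> 0\<close> unfolding a_def b_def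
        by (simp only: abs_mult) (intro mult_mono, auto)
      then show ?thesis
        unfolding a_def b_def by (simp add: add_divide_distrib[symmetric] ac_simps del: of_nat_Suc)
    qed
  qed
  then have "convergent (\<lambda>n. \<Sum>k<n. w (Suc k) ^ 3 - w k ^ 3)"
    by (simp add: summable_iff_convergent)
  then obtain l where "(\<lambda>n. w n ^ 3 - w 0 ^ 3) \<longlonglongrightarrow> l"
    by (auto simp: convergent_def sum_lessThan_telescope[of "\<lambda>n. w n ^ 3"])
  then have "(\<lambda>n. (w n ^ 3 - w 0 ^ 3) + w 0 ^ 3) \<longlonglongrightarrow> l + w 0 ^ 3"
    by (intro tendsto_intros)
  \<comment> \<open>An odd root is continuous on all reals and recovers \<open>w n\<close> together
    with its sign.\<close>
  then have "(\<lambda>n. root 3 (w n ^ 3)) \<longlonglongrightarrow> root 3 (l + w 0 ^ 3)"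
    by (intro tendsto_real_root) simp
  then obtain L where L: "w \<longlonglongrightarrow> L"
    by (auto simp: odd_real_root_power_cancel)
  have "L = 0"
  proof (rule ccontr)
    assume "L \<noteq> 0"
    then have "L\<^sup>2 / 2 < L\<^sup>2"
      by simp
    moreover have "(\<lambda>n. (w n)\<^sup>2) \<longlonglongrightarrow> L\<^sup>2"
      by (intro tendsto_power L)
    ultimately have "eventually (\<lambda>n. L\<^sup>2 / 2 < (w n)\<^sup>2) sequentially"
      by (rule order_tendstoD(1)[rotated])
    then have "eventually (\<lambda>n. norm (L\<^sup>2 / 2 / real (Suc n)) \<le> (w n)\<^sup>2 / real (Suc n)) sequentially"
    proof eventually_elim
      case (elim n)
      then have "L\<^sup>2 / 2 / real (Suc n) \<le> (w n)\<^sup>2 / real (Suc n)"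
        by (intro divide_right_mono) auto
      then show ?case
        by (simp del: of_nat_Suc)
    qed
    from summable_comparison_test_ev[OF this summ]
    have "summable (\<lambda>n. L\<^sup>2 / 2 * inverse (real (Suc n)))"
      by (simp only: divide_inverse)
    then have "summable (\<lambda>n. inverse (real (Suc n)))"
      by (rule summable_mult_D) (use \<open>L \<noteq> 0\<close> in simp)
    then show False
      using not_summable_harmonic[where 'a = real] summable_Suc_iff[of "\<lambda>n. inverse (real n)"]
      by simp
  qed
  with L show ?thesis
    by simp
qed

text \<open>The sigma-algebras generated by f and g lie inside F and G, so independence passes down
  to the two variables, for which the product rule is known.\<close>

lemma (in prob_space) expectation_mult_indep_set:
  fixes f g :: "'a \<Rightarrow> real"
  assumes indep: "indep_set (sets F) (sets G)"
    and spaces: "space F = space M" "space G = space M"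
    and f: "f \<in> borel_measurable F" "integrable M f"
    and g: "g \<in> borel_measurable G" "integrable M g"
  shows "expectation (\<lambda>\<omega>. f \<omega> * g \<omega>) = expectation f * expectation g"
proof (rule indep_var_lebesgue_integral)
  have "sigma_sets (space M) {h -` A \<inter> space M |A. A \<in> sets borel} \<subseteq> sets H"
    if "h \<in> borel_measurable H" "space H = space M" for h :: "'a \<Rightarrow> real" and H
    unfolding that(2)[symmetric] using that(1)
    by (intro sets.sigma_sets_subset) (auto dest: measurable_sets)
  from this[OF f(1) spaces(1)] this[OF g(1) spaces(2)]
  show "indep_var borel f borel g"
    using indep f(2) g(2) unfolding indep_var_eq indep_set_def
    by (auto elim!: indep_sets_mono_sets simp: subset_iff split: bool.split)
qed (fact f g)+

section \<open>Imbalance of an urn configuration\<close>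

text \<open>This is 2X - 1. For an empty urn division by zero gives 0, so the bound by 1 holds for
  all arguments, as the boundedness hypotheses of the expectation lemmas require.\<close>

definition imbalance :: "nat \<Rightarrow> nat \<Rightarrow> real"
  where "imbalance y b = (real y - real b) / real (y + b)"

lemma abs_imbalance_le_1: "\<bar>imbalance y b\<bar> \<le> 1"
  unfolding imbalance_def abs_divide
  by (cases "y + b = 0") (auto simp: divide_le_eq_1)

text \<open>With w the old imbalance and T = y + b, the colour difference changes from w T to w T +
  (i - j). Hence the change of imbalance is ((i - j) - w (i + j)) / (T + i + j), and |w| \<le> 1
  bounds the numerator.\<close>

lemma abs_imbalance_add_le:
  assumes "y + b > 0"
  shows "\<bar>imbalance (y + i) (b + j) - imbalance y b\<bar> \<le> 2 * real (i + j) / real (y + b)"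
proof -
  define w where "w = imbalance y b"
  have T: "real y - real b = w * real (y + b)"
    using assms by (simp add: w_def imbalance_def)
  have "imbalance (y + i) (b + j) = (w * real (y + b) + (real i - real j)) / real (y + b + i + j)"
    unfolding T[symmetric] by (simp add: imbalance_def algebra_simps)
  also have "w * real (y + b) + (real i - real j)
      = w * real (y + b + i + j) + ((real i - real j) - w * real (i + j))"
    by (simp add: algebra_simps)
  finally have "imbalance (y + i) (b + j) - w
      = ((real i - real j) - w * real (i + j)) / real (y + b + i + j)"
    using assms by (auto simp: add_divide_distrib simp del: of_nat_add)
  moreover have "\<bar>(real i - real j) - w * real (i + j)\<bar> \<le> 2 * real (i + j)"
  proof -
    define q where "q = w * real (i + j)"
    have "\<bar>q\<bar> \<le> 1 * real (i + j)"
      using abs_imbalance_le_1[of y b] unfolding abs_mult w_def q_def by (intro mult_mono) auto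
    then show ?thesis
      unfolding q_def[symmetric] by (simp add: abs_le_iff)
  qed
  ultimately show ?thesis
    using assms by (auto simp: abs_divide w_def intro!: frac_le)
qed

section \<open>Measurability of the urn process\<close>

context friedman_polya_urn
begin

text \<open>The one-step transition operator of the Markov chain (Y, B) applied to f; the first
  bracket is the Friedman step, the second the Polya step. It is used only in integrated form,
  through \<open>expectation_Suc\<close>.\<close>

definition transition :: "(nat \<Rightarrow> nat \<Rightarrow> real) \<Rightarrow> nat \<Rightarrow> nat \<Rightarrow> real"
  where "transition f y b = (let x = real y / real (y + b) in
     p * (x * f (y + \<alpha>) (b + \<beta>) + (1 - x) * f (y + \<beta>) (b + \<alpha>))
     + (1 - p) * (x * f (y + \<gamma>) b + (1 - x) * f y (b + \<gamma>)))"

lemma zeta_cases: "\<omega> \<in> space M \<Longrightarrow> \<zeta> (Suc n) \<omega> = 0 \<or> \<zeta> (Suc n) \<omega> = 1"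
  using measurable_space[OF zeta_rv] by fastforce

lemma xi_cases: "\<omega> \<in> space M \<Longrightarrow> \<xi> (Suc n) \<omega> = 0 \<or> \<xi> (Suc n) \<omega> = 1"
  using measurable_space[OF xi_rv] by fastforce

lemma measurable_zeta [measurable]: "\<zeta> (Suc n) \<in> M \<rightarrow>\<^sub>M count_space UNIV"
  by (rule measurable_compose[OF zeta_rv]) simp

lemma measurable_xi [measurable]: "\<xi> (Suc n) \<in> M \<rightarrow>\<^sub>M count_space UNIV"
  by (rule measurable_compose[OF xi_rv]) simp

lemma measurable_Y_B:
  "Y n \<in> M \<rightarrow>\<^sub>M count_space UNIV \<and> B n \<in> M \<rightarrow>\<^sub>M count_space UNIV"
proof (induction n)
  case 0
  show ?case
    by (simp add: Y_init B_init cong: measurable_cong)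
next
  case (Suc n)
  then have [measurable]: "Y n \<in> M \<rightarrow>\<^sub>M count_space UNIV" "B n \<in> M \<rightarrow>\<^sub>M count_space UNIV"
    by auto
  show ?case
    by (simp add: Y_step B_step cong: measurable_cong)
qed

lemma measurable_Y [measurable]: "Y n \<in> M \<rightarrow>\<^sub>M count_space UNIV"
  and measurable_B [measurable]: "B n \<in> M \<rightarrow>\<^sub>M count_space UNIV"
  using measurable_Y_B by auto

lemma space_natural_filtration [simp]: "space (natural_filtration M Y B n) = space M"
  unfolding natural_filtration_def by (rule space_measure_of_conv)

lemma sets_natural_filtration:
  "sets (natural_filtration M Y B n) = sigma_sets (space M)
     (\<Union>k\<in>{..n}. sets (vimage_algebra (space M) (\<lambda>\<omega>. (Y k \<omega>, B k \<omega>)) (count_space UNIV)))"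
  unfolding natural_filtration_def
  by (rule sets_measure_of) (fastforce dest!: sets.sets_into_space)

lemma subalgebra_natural_filtration: "subalgebra M (natural_filtration M Y B n)"
proof -
  have "(\<lambda>\<omega>. (Y k \<omega>, B k \<omega>)) \<in> M \<rightarrow>\<^sub>M count_space UNIV" for k
    by measurable
  then show ?thesis
    unfolding subalgebra_def sets_natural_filtration
    by (auto intro!: sets.sigma_sets_subset simp: sets_vimage_algebra2 dest: measurable_sets)
qed

lemma measurable_natural_filtration:
  fixes f :: "nat \<Rightarrow> nat \<Rightarrow> real"
  shows "(\<lambda>\<omega>. f (Y n \<omega>) (B n \<omega>)) \<in> borel_measurable (natural_filtration M Y B n)"
proof -
  let ?V = "vimage_algebra (space M) (\<lambda>\<omega>. (Y n \<omega>, B n \<omega>)) (count_space UNIV)"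
  have "(\<lambda>\<omega>. (Y n \<omega>, B n \<omega>)) \<in> ?V \<rightarrow>\<^sub>M count_space UNIV"
    by (rule measurable_vimage_algebra1) auto
  from measurable_compose[OF this, of "\<lambda>(y, b). f y b" borel]
  have "(\<lambda>\<omega>. f (Y n \<omega>) (B n \<omega>)) \<in> borel_measurable ?V"
    by simp
  moreover have "sets ?V \<subseteq> sets (natural_filtration M Y B n)"
    unfolding sets_natural_filtration by auto
  ultimately show ?thesis
    unfolding measurable_def by auto
qed

lemma integrable_bounded_urn:
  fixes f :: "nat \<Rightarrow> nat \<Rightarrow> real"
  assumes "\<And>y b. \<bar>f y b\<bar> \<le> C"
  shows "integrable M (\<lambda>\<omega>. f (Y n \<omega>) (B n \<omega>))"
  using assms measurable_from_subalg[OF subalgebra_natural_filtration measurable_natural_filtration]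
  by (intro integrable_const_bound[where B = C]) auto

section \<open>Expectation after one step of the urn\<close>

text \<open>Since \<open>f (Y n \<omega>) (B n \<omega>)\<close> is measurable for the natural
  filtration, the indicator of the colour may be replaced under the integral by its conditional
  expectation, which the urn model prescribes.\<close>

lemma expectation_zeta:
  assumes f: "\<And>y b. \<bar>f y b\<bar> \<le> C"
  shows "expectation (\<lambda>\<omega>. f (Y n \<omega>) (B n \<omega>) * indicator {\<omega> \<in> space M. \<zeta> (Suc n) \<omega> = 1} \<omega>)
      = expectation (\<lambda>\<omega>. f (Y n \<omega>) (B n \<omega>) * proportion Y B n \<omega>)" (is ?yellow)
    and "expectation (\<lambda>\<omega>. f (Y n \<omega>) (B n \<omega>) * indicator {\<omega> \<in> space M. \<zeta> (Suc n) \<omega> = 0} \<omega>)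
      = expectation (\<lambda>\<omega>. f (Y n \<omega>) (B n \<omega>) * (1 - proportion Y B n \<omega>))" (is ?blue)
proof -
  let ?F = "natural_filtration M Y B n"
  interpret F: finite_measure_subalgebra M ?F
    by unfold_locales (rule subalgebra_natural_filtration)
  note [measurable] = measurable_natural_filtration[of f n]
    measurable_from_subalg[OF subalgebra_natural_filtration measurable_natural_filtration[of f n]]
  have [measurable]: "proportion Y B n \<in> borel_measurable M"
    unfolding proportion_def by measurable
  have *: "expectation (\<lambda>\<omega>. f (Y n \<omega>) (B n \<omega>) * indicator {\<omega> \<in> space M. \<zeta> (Suc n) \<omega> = z} \<omega>)
      = expectation (\<lambda>\<omega>. f (Y n \<omega>) (B n \<omega>) * h \<omega>)"
    if "AE \<omega> in M. real_cond_exp M ?F (indicator {\<omega> \<in> space M. \<zeta> (Suc n) \<omega> = z}) \<omega> = h \<omega>"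
      and [measurable]: "h \<in> borel_measurable M" for z h
  proof -
    have "integrable M (\<lambda>\<omega>. f (Y n \<omega>) (B n \<omega>) * indicator {\<omega> \<in> space M. \<zeta> (Suc n) \<omega> = z} \<omega>)"
      by (rule integrable_real_mult_indicator) (auto intro: integrable_bounded_urn f)
    from F.real_cond_exp_intg(2)[OF this]
    have "expectation (\<lambda>\<omega>. f (Y n \<omega>) (B n \<omega>) * indicator {\<omega> \<in> space M. \<zeta> (Suc n) \<omega> = z} \<omega>)
      = expectation (\<lambda>\<omega>. f (Y n \<omega>) (B n \<omega>) *
          real_cond_exp M ?F (indicator {\<omega> \<in> space M. \<zeta> (Suc n) \<omega> = z}) \<omega>)"
      by simp
    also have "\<dots> = expectation (\<lambda>\<omega>. f (Y n \<omega>) (B n \<omega>) * h \<omega>)"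
      using that(1) by (intro integral_cong_AE) auto
    finally show ?thesis .
  qed
  show ?yellow
    using zeta_yellow by (intro *) auto
  show ?blue
    using zeta_blue[of n] by (intro *) auto
qed

text \<open>The scheme is independent of the sigma-algebra generated jointly by the past and the
  drawn colour, and the remaining factor is measurable for the latter.\<close>

lemma expectation_xi_zeta:
  assumes f: "\<And>y b. \<bar>f y b\<bar> \<le> C" and i: "i \<in> {0, 1}" and j: "j \<in> {0, 1}"
  shows "expectation (\<lambda>\<omega>. indicator {\<omega> \<in> space M. \<xi> (Suc n) \<omega> = i} \<omega> *
        (f (Y n \<omega>) (B n \<omega>) * indicator {\<omega> \<in> space M. \<zeta> (Suc n) \<omega> = j} \<omega>))
    = prob {\<omega> \<in> space M. \<xi> (Suc n) \<omega> = i} *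
      expectation (\<lambda>\<omega>. f (Y n \<omega>) (B n \<omega>) * indicator {\<omega> \<in> space M. \<zeta> (Suc n) \<omega> = j} \<omega>)"
proof -
  let ?X = "vimage_algebra (space M) (\<xi> (Suc n)) (count_space {0, 1})"
  let ?Z = "vimage_algebra (space M) (\<zeta> (Suc n)) (count_space {0, 1})"
  let ?S = "sets (natural_filtration M Y B n) \<union> sets ?Z"
  let ?G = "sigma (space M) ?S"
  have "?S \<subseteq> Pow (space M)"
    by (fastforce dest!: sets.sets_into_space)
  then have sets_G: "sets ?G = sigma_sets (space M) ?S"
    by (rule sets_measure_of)
  have space_G: "space ?G = space M"
    by (rule space_measure_of_conv)
  \<comment> \<open>The restriction of i and j to {0, 1} enters here: it makes the singletons
    measurable in \<open>count_space {0, 1}\<close>.\<close>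
  have level: "{\<omega> \<in> space M. h \<omega> = k} \<in> sets (vimage_algebra (space M) h (count_space {0, 1}))"
    if "k \<in> {0, 1}" for h :: "'a \<Rightarrow> nat" and k
    using in_vimage_algebra[of "{k}" "count_space {0, 1}" h "space M"] that
    by (simp add: vimage_def Int_def conj_commute)
  have "(\<lambda>\<omega>. f (Y n \<omega>) (B n \<omega>)) \<in> borel_measurable ?G"
    using measurable_natural_filtration[of f n] sets_G space_G
    unfolding measurable_def by auto
  moreover have "{\<omega> \<in> space M. \<zeta> (Suc n) \<omega> = j} \<in> sets ?G"
    unfolding sets_G using level[OF j] by auto
  ultimately have 1: "(\<lambda>\<omega>. f (Y n \<omega>) (B n \<omega>) * indicator {\<omega> \<in> space M. \<zeta> (Suc n) \<omega> = j} \<omega>)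
      \<in> borel_measurable ?G"
    by (intro borel_measurable_times borel_measurable_indicator)
  have 2: "indicator {\<omega> \<in> space M. \<xi> (Suc n) \<omega> = i} \<in> borel_measurable ?X"
    by (intro borel_measurable_indicator level i)
  have 3: "integrable M (\<lambda>\<omega>. f (Y n \<omega>) (B n \<omega>) * indicator {\<omega> \<in> space M. \<zeta> (Suc n) \<omega> = j} \<omega>)"
    by (rule integrable_real_mult_indicator) (auto intro: integrable_bounded_urn f)
  have "integrable M (indicator {\<omega> \<in> space M. \<xi> (Suc n) \<omega> = i} :: 'a \<Rightarrow> real)"
    by (simp add: emeasure_eq_measure)
  from expectation_mult_indep_set[OF xi_indep _ space_G 2 this 1 3] show ?thesis
    by (simp add: Int_absorb1 subset_eq)
qed

text \<open>On each of the four events given by scheme and colour the new configuration is a fixed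
  shift of the old one. The previous two lemmas, applied to the shifted f, evaluate each
  contribution.\<close>

lemma expectation_Suc:
  assumes f: "\<And>y b. \<bar>f y b\<bar> \<le> C"
  shows "expectation (\<lambda>\<omega>. f (Y (Suc n) \<omega>) (B (Suc n) \<omega>))
    = expectation (\<lambda>\<omega>. transition f (Y n \<omega>) (B n \<omega>))"
proof -
  define X where "X i = (indicator {\<omega> \<in> space M. \<xi> (Suc n) \<omega> = i} :: 'a \<Rightarrow> real)" for i
  define Z where "Z j = (indicator {\<omega> \<in> space M. \<zeta> (Suc n) \<omega> = j} :: 'a \<Rightarrow> real)" for j
  define g where "g a b \<omega> = f (Y n \<omega> + a) (B n \<omega> + b)" for a b \<omega>
  have g: "integrable M (g a b)" for a b
    using integrable_bounded_urn[of "\<lambda>y x. f (y + a) (x + b)" C n] f by (simp add: g_def[abs_def])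
  have XZ: "integrable M (\<lambda>\<omega>. X i \<omega> * (g a b \<omega> * Z j \<omega>))" for i j a b
    unfolding X_def Z_def
    by (subst mult.commute) (intro integrable_real_mult_indicator g; simp)
  have P: "integrable M (\<lambda>\<omega>. g a b \<omega> * proportion Y B n \<omega>)" for a b
  proof (rule Bochner_Integration.integrable_bound[OF g])
    show "(\<lambda>\<omega>. g a b \<omega> * proportion Y B n \<omega>) \<in> borel_measurable M"
      unfolding proportion_def using borel_measurable_integrable[OF g] by measurable
    show "AE \<omega> in M. norm (g a b \<omega> * proportion Y B n \<omega>) \<le> norm (g a b \<omega>)"
      by (intro AE_I2)
        (auto simp: proportion_def abs_mult divide_le_eq_1 simp del: times_divide_eq_right
          intro!: mult_left_le)
  qed
  have Q: "integrable M (\<lambda>\<omega>. g a b \<omega> * (1 - proportion Y B n \<omega>))" for a b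
    unfolding right_diff_distrib using g P by simp
  have p: "prob {\<omega> \<in> space M. \<xi> (Suc n) \<omega> = 1} = p" "prob {\<omega> \<in> space M. \<xi> (Suc n) \<omega> = 0} = 1 - p"
    using xi_Friedman[of n] xi_Polya[of n] by simp_all
  have E: "expectation (\<lambda>\<omega>. X i \<omega> * (g a b \<omega> * Z j \<omega>)) = (if i = 1 then p else 1 - p) *
     expectation (\<lambda>\<omega>. g a b \<omega> * (if j = 1 then proportion Y B n \<omega> else 1 - proportion Y B n \<omega>))"
    if "i \<in> {0, 1}" "j \<in> {0, 1}" for i j a b
    using expectation_xi_zeta[of "\<lambda>y x. f (y + a) (x + b)" C i j n]
      expectation_zeta[of "\<lambda>y x. f (y + a) (x + b)" C n] f that p
    unfolding X_def Z_def g_def by auto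
  \<comment> \<open>At every point exactly one of the four products of indicators is 1.\<close>
  have "expectation (\<lambda>\<omega>. f (Y (Suc n) \<omega>) (B (Suc n) \<omega>)) = expectation (\<lambda>\<omega>.
      X 1 \<omega> * (g \<alpha> \<beta> \<omega> * Z 1 \<omega>) + X 1 \<omega> * (g \<beta> \<alpha> \<omega> * Z 0 \<omega>)
      + (X 0 \<omega> * (g \<gamma> 0 \<omega> * Z 1 \<omega>) + X 0 \<omega> * (g 0 \<gamma> \<omega> * Z 0 \<omega>)))"
  proof (rule Bochner_Integration.integral_cong[OF refl])
    fix \<omega> assume "\<omega> \<in> space M"
    with zeta_cases[OF this, of n] xi_cases[OF this, of n]
    show "f (Y (Suc n) \<omega>) (B (Suc n) \<omega>) =
      X 1 \<omega> * (g \<alpha> \<beta> \<omega> * Z 1 \<omega>) + X 1 \<omega> * (g \<beta> \<alpha> \<omega> * Z 0 \<omega>)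
      + (X 0 \<omega> * (g \<gamma> 0 \<omega> * Z 1 \<omega>) + X 0 \<omega> * (g 0 \<gamma> \<omega> * Z 0 \<omega>))"
      by (auto simp: Y_step B_step X_def Z_def g_def)
  qed
  also have "\<dots> = expectation (\<lambda>\<omega>.
      p * (g \<alpha> \<beta> \<omega> * proportion Y B n \<omega>) + p * (g \<beta> \<alpha> \<omega> * (1 - proportion Y B n \<omega>))
      + ((1 - p) * (g \<gamma> 0 \<omega> * proportion Y B n \<omega>)
        + (1 - p) * (g 0 \<gamma> \<omega> * (1 - proportion Y B n \<omega>))))"
    using XZ P Q by (simp add: E)
  also have "\<dots> = expectation (\<lambda>\<omega>. transition f (Y n \<omega>) (B n \<omega>))"
    unfolding transition_def Let_def g_def proportion_def[of Y B n, symmetric] add_0_right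
    by (simp add: algebra_simps)
  finally show ?thesis .
qed

section \<open>Drift of the squared imbalance\<close>

text \<open>Only the Friedman step produces the negative term of order w^2 / T; both schemes
  contribute a variance error of order 1 / T^2.\<close>

lemma transition_square_imbalance_le:
  assumes p: "0 < p" "p \<le> 1"
    and total: "y + b > 0"
  defines "s \<equiv> real (\<alpha> + \<beta>)" and "T \<equiv> real (y + b)"
  shows "transition (\<lambda>y b. (imbalance y b)\<^sup>2) y b
    \<le> (imbalance y b)\<^sup>2 - 4 * p * \<beta> / (1 + s)\<^sup>2 * ((imbalance y b)\<^sup>2 / T)
      + (s\<^sup>2 + (real \<gamma>)\<^sup>2) / T\<^sup>2"
proof -
  define w where "w = imbalance y b"
  have T: "T \<ge> 1"
    using total unfolding T_def by linarith
  have s: "s \<ge> 0"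
    by (simp add: s_def)
  have D: "real y - real b = w * T"
    using total by (simp add: w_def imbalance_def T_def)
  have x: "real y / real (y + b) = (1 + w) / 2"
    using D total T by (simp add: T_def field_simps)
  \<comment> \<open>Average over the drawn colour when it gains i balls and the other colour j;
    (\<alpha>, \<beta>) is the Friedman case and (\<gamma>, 0) the Polya case. The cross term
    carries 2x - 1 = w for x = (1 + w) / 2, so w^2 factors out of it too.\<close>
  have avg: "(1 + w) / 2 * (imbalance (y + i) (b + j))\<^sup>2
      + (1 - (1 + w) / 2) * (imbalance (y + j) (b + i))\<^sup>2
    = ((T\<^sup>2 + 2 * (real i - real j) * T) * w\<^sup>2 + (real i - real j)\<^sup>2) / (T + real (i + j))\<^sup>2"
    for i j
  proof -
    have "imbalance (y + i) (b + j) = (w * T + (real i - real j)) / (T + real (i + j))"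
      using D by (simp add: imbalance_def T_def algebra_simps)
    moreover have "imbalance (y + j) (b + i) = (w * T - (real i - real j)) / (T + real (i + j))"
      using D by (simp add: imbalance_def T_def algebra_simps)
    moreover have "(1 + w) / 2 * (w * T + q)\<^sup>2 + (1 - (1 + w) / 2) * (w * T - q)\<^sup>2
        = (T\<^sup>2 + 2 * q * T) * w\<^sup>2 + q\<^sup>2" for q
      by (simp add: power2_eq_square field_simps)
    ultimately show ?thesis
      by (simp only: power_divide times_divide_eq_right add_divide_distrib[symmetric])
  qed
  have friedman: "((T\<^sup>2 + 2 * (real \<alpha> - real \<beta>) * T) * w\<^sup>2 + (real \<alpha> - real \<beta>)\<^sup>2) / (T + s)\<^sup>2
    \<le> w\<^sup>2 - 4 * \<beta> / (1 + s)\<^sup>2 * (w\<^sup>2 / T) + s\<^sup>2 / T\<^sup>2"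
  proof -
    have "T\<^sup>2 + 2 * (real \<alpha> - real \<beta>) * T \<le> (T + s)\<^sup>2 - 4 * \<beta> * T"
      by (simp add: s_def power2_eq_square algebra_simps)
    then have "(T\<^sup>2 + 2 * (real \<alpha> - real \<beta>) * T) / (T + s)\<^sup>2 \<le> ((T + s)\<^sup>2 - 4 * \<beta> * T) / (T + s)\<^sup>2"
      by (rule divide_right_mono) simp
    also have "\<dots> = 1 - 4 * \<beta> * T / (T + s)\<^sup>2"
      using T s by (simp add: diff_divide_distrib)
    \<comment> \<open>From T \<ge> 1 one gets T + s \<le> (1 + s) T; this is the origin of the
      factor (1 + s)^2 in the constant.\<close>
    also have "\<dots> \<le> 1 - 4 * \<beta> / (1 + s)\<^sup>2 / T"
    proof -
      have "T + s \<le> (1 + s) * T"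
        using mult_left_mono[OF T s] by (simp add: algebra_simps)
      then have "(T + s)\<^sup>2 \<le> ((1 + s) * T)\<^sup>2"
        using T s by (intro power_mono) auto
      then have "4 * \<beta> * T / ((1 + s) * T)\<^sup>2 \<le> 4 * \<beta> * T / (T + s)\<^sup>2"
        using T s by (intro divide_left_mono mult_pos_pos zero_less_power) auto
      then show ?thesis
        using T s by (simp add: power2_eq_square mult.assoc)
    qed
    finally have "(T\<^sup>2 + 2 * (real \<alpha> - real \<beta>) * T) / (T + s)\<^sup>2 * w\<^sup>2
        \<le> (1 - 4 * \<beta> / (1 + s)\<^sup>2 / T) * w\<^sup>2"
      by (rule mult_right_mono) simp
    moreover have "(real \<alpha> - real \<beta>)\<^sup>2 / (T + s)\<^sup>2 \<le> s\<^sup>2 / T\<^sup>2"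
    proof (rule frac_le)
      have "\<bar>real \<alpha> - real \<beta>\<bar> \<le> \<bar>s\<bar>"
        by (simp add: s_def)
      then show "(real \<alpha> - real \<beta>)\<^sup>2 \<le> s\<^sup>2"
        by (simp add: abs_le_square_iff)
      show "T\<^sup>2 \<le> (T + s)\<^sup>2"
        using T s by (intro power_mono) auto
    qed (use T in auto)
    ultimately have "(T\<^sup>2 + 2 * (real \<alpha> - real \<beta>) * T) / (T + s)\<^sup>2 * w\<^sup>2
          + (real \<alpha> - real \<beta>)\<^sup>2 / (T + s)\<^sup>2
        \<le> (1 - 4 * \<beta> / (1 + s)\<^sup>2 / T) * w\<^sup>2 + s\<^sup>2 / T\<^sup>2"
      by (rule add_mono)
    also have "(1 - 4 * \<beta> / (1 + s)\<^sup>2 / T) * w\<^sup>2 = w\<^sup>2 - 4 * \<beta> / (1 + s)\<^sup>2 * (w\<^sup>2 / T)"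
      by (simp add: left_diff_distrib)
    finally show ?thesis
      by (simp only: times_divide_eq_left add_divide_distrib[symmetric])
  qed
  \<comment> \<open>The form with \<open>- 0\<close> matches \<open>avg\<close> at j = 0. The
    coefficient of w^2 is at most 1 because T^2 + 2 \<gamma> T = (T + \<gamma>)^2 -
    \<gamma>^2.\<close>
  have polya: "((T\<^sup>2 + 2 * (real \<gamma> - 0) * T) * w\<^sup>2 + (real \<gamma> - 0)\<^sup>2) / (T + \<gamma>)\<^sup>2
    \<le> w\<^sup>2 + (real \<gamma>)\<^sup>2 / T\<^sup>2"
  proof -
    have "(T\<^sup>2 + 2 * (real \<gamma> - 0) * T) / (T + \<gamma>)\<^sup>2 \<le> 1"
      using T by (simp add: divide_le_eq_1) (simp add: power2_eq_square algebra_simps)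
    from mult_right_mono[OF this, of "w\<^sup>2"]
    have "(T\<^sup>2 + 2 * (real \<gamma> - 0) * T) / (T + \<gamma>)\<^sup>2 * w\<^sup>2 \<le> w\<^sup>2"
      by simp
    moreover have "(real \<gamma>)\<^sup>2 / (T + \<gamma>)\<^sup>2 \<le> (real \<gamma>)\<^sup>2 / T\<^sup>2"
      using T by (intro frac_le power_mono) auto
    ultimately have "(T\<^sup>2 + 2 * (real \<gamma> - 0) * T) / (T + \<gamma>)\<^sup>2 * w\<^sup>2 + (real \<gamma>)\<^sup>2 / (T + \<gamma>)\<^sup>2
        \<le> w\<^sup>2 + (real \<gamma>)\<^sup>2 / T\<^sup>2"
      by (rule add_mono)
    then show ?thesis
      by (simp only: times_divide_eq_left add_divide_distrib[symmetric] diff_0_right)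
  qed
  have "transition (\<lambda>y b. (imbalance y b)\<^sup>2) y b =
      p * (((T\<^sup>2 + 2 * (real \<alpha> - real \<beta>) * T) * w\<^sup>2 + (real \<alpha> - real \<beta>)\<^sup>2) / (T + s)\<^sup>2)
      + (1 - p) * (((T\<^sup>2 + 2 * (real \<gamma> - 0) * T) * w\<^sup>2 + (real \<gamma> - 0)\<^sup>2) / (T + \<gamma>)\<^sup>2)"
    using avg[of \<alpha> \<beta>] avg[of \<gamma> 0] unfolding transition_def Let_def x s_def by simp
  also have "\<dots> \<le> p * (w\<^sup>2 - 4 * \<beta> / (1 + s)\<^sup>2 * (w\<^sup>2 / T) + s\<^sup>2 / T\<^sup>2)
      + (1 - p) * (w\<^sup>2 + (real \<gamma>)\<^sup>2 / T\<^sup>2)"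
    using p friedman polya by (intro add_mono mult_left_mono) auto
  also have "\<dots> = w\<^sup>2 - 4 * p * \<beta> / (1 + s)\<^sup>2 * (w\<^sup>2 / T)
      + (p * (s\<^sup>2 / T\<^sup>2) + (1 - p) * ((real \<gamma>)\<^sup>2 / T\<^sup>2))"
    by (simp add: algebra_simps)
  also have "p * (s\<^sup>2 / T\<^sup>2) + (1 - p) * ((real \<gamma>)\<^sup>2 / T\<^sup>2) \<le> s\<^sup>2 / T\<^sup>2 + (real \<gamma>)\<^sup>2 / T\<^sup>2"
    using p by (intro add_mono mult_left_le_one_le) auto
  finally show ?thesis
    by (simp add: w_def add_divide_distrib)
qed

section \<open>Pathwise bounds on the total and on the increments\<close>

text \<open>Each step adds \<alpha> + \<beta> or \<gamma> balls. The lower bound makes increments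
  and variance errors small; the upper bound keeps the contraction at least of order 1 /
  (n+1).\<close>

lemma total_bounds:
  assumes "y0 > 0" "\<alpha> > 0" "\<gamma> > 0" "\<omega> \<in> space M"
  shows "Suc n \<le> Y n \<omega> + B n \<omega>"
    and "Y n \<omega> + B n \<omega> \<le> (y0 + b0 + \<alpha> + \<beta> + \<gamma>) * Suc n"
proof -
  have "Suc n \<le> Y n \<omega> + B n \<omega> \<and> Y n \<omega> + B n \<omega> \<le> (y0 + b0 + \<alpha> + \<beta> + \<gamma>) * Suc n"
  proof (induction n)
    case 0
    then show ?case
      using assms by (simp add: Y_init B_init)
  next
    case (Suc n)
    then show ?case
      using zeta_cases[OF assms(4), of n] xi_cases[OF assms(4), of n] assms
      by (auto simp: Y_step B_step)
  qed
  then show "Suc n \<le> Y n \<omega> + B n \<omega>"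
    and "Y n \<omega> + B n \<omega> \<le> (y0 + b0 + \<alpha> + \<beta> + \<gamma>) * Suc n"
    by auto
qed

lemma imbalance_step:
  assumes "y0 > 0" "\<alpha> > 0" "\<gamma> > 0" "\<omega> \<in> space M"
  shows "\<bar>imbalance (Y (Suc n) \<omega>) (B (Suc n) \<omega>) - imbalance (Y n \<omega>) (B n \<omega>)\<bar>
    \<le> 2 * real (\<alpha> + \<beta> + \<gamma>) / real (Suc n)"
proof -
  obtain i j where ij: "Y (Suc n) \<omega> = Y n \<omega> + i" "B (Suc n) \<omega> = B n \<omega> + j" "i + j \<le> \<alpha> + \<beta> + \<gamma>"
    using zeta_cases[OF assms(4), of n] xi_cases[OF assms(4), of n] assms(4)
    by (fastforce simp: Y_step B_step)
  have *: "2 * real (i + j) / real (Y n \<omega> + B n \<omega>) \<le> 2 * real (\<alpha> + \<beta> + \<gamma>) / real (Suc n)"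
    using total_bounds(1)[OF assms, of n] ij(3) by (intro frac_le) (auto simp del: of_nat_Suc of_nat_add)
  have "0 < Y n \<omega> + B n \<omega>"
    using total_bounds(1)[OF assms, of n] by linarith
  from abs_imbalance_add_le[OF this, of i j] show ?thesis
    unfolding ij(1,2) by (rule order_trans) (rule *)
qed

section \<open>Summability in expectation and almost sure convergence\<close>

lemma summable_expectation_square_imbalance:
  assumes pos: "y0 > 0" "\<alpha> > 0" "\<beta> > 0" "\<gamma> > 0" and p: "0 < p" "p \<le> 1"
  shows "summable (\<lambda>n. expectation (\<lambda>\<omega>. (imbalance (Y n \<omega>) (B n \<omega>))\<^sup>2) / real (Suc n))"
proof -
  define a where "a n = expectation (\<lambda>\<omega>. (imbalance (Y n \<omega>) (B n \<omega>))\<^sup>2)" for n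
  define K where "K = real (y0 + b0 + \<alpha> + \<beta> + \<gamma>)"
  \<comment> \<open>The constants c and d come from the drift inequality, K from the upper bound on
    the total; the contraction rate becomes c / K per 1 / (n+1).\<close>
  define c where "c = 4 * p * \<beta> / (1 + real (\<alpha> + \<beta>))\<^sup>2"
  define d where "d = (real (\<alpha> + \<beta>))\<^sup>2 + (real \<gamma>)\<^sup>2"
  have K: "K > 0" and c: "c > 0" and d: "d \<ge> 0"
    using pos p by (auto simp: K_def c_def d_def intro!: divide_pos_pos mult_pos_pos)
  have int: "integrable M (\<lambda>\<omega>. (imbalance (Y n \<omega>) (B n \<omega>))\<^sup>2)" for n
    by (rule integrable_bounded_urn[where C = 1])
      (simp add: abs_imbalance_le_1 abs_square_le_1)
  have nonneg: "a n \<ge> 0" for n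
    unfolding a_def by (rule integral_nonneg_AE) simp
  have step: "a (Suc n) \<le> a n - c / K * (a n / real (Suc n)) + d * inverse (real (Suc n) ^ 2)" for n
  proof -
    let ?w = "\<lambda>\<omega>. (imbalance (Y n \<omega>) (B n \<omega>))\<^sup>2"
    let ?r = "d * inverse (real (Suc n) ^ 2)"
    have "a (Suc n) = expectation (\<lambda>\<omega>. transition (\<lambda>y b. (imbalance y b)\<^sup>2) (Y n \<omega>) (B n \<omega>))"
      unfolding a_def
      by (rule expectation_Suc[where C = 1]) (simp add: abs_imbalance_le_1 abs_square_le_1)
    also have "\<dots> \<le> expectation (\<lambda>\<omega>. ?w \<omega> - c / K / real (Suc n) * ?w \<omega> + ?r)"
    \<comment> \<open>This comparison asks for integrability and nonnegativity of the larger side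
      only; the latter is inherited from \<open>transition\<close>.\<close>
    proof (rule integral_mono_AE')
      show "integrable M (\<lambda>\<omega>. ?w \<omega> - c / K / real (Suc n) * ?w \<omega> + ?r)"
        using int by simp
      have le: "transition (\<lambda>y b. (imbalance y b)\<^sup>2) (Y n \<omega>) (B n \<omega>)
          \<le> ?w \<omega> - c / K / real (Suc n) * ?w \<omega> + ?r" if "\<omega> \<in> space M" for \<omega>
      proof -
        define T where "T = real (Y n \<omega> + B n \<omega>)"
        have T: "real (Suc n) \<le> T" "T \<le> K * real (Suc n)"
          using total_bounds[OF pos(1,2,4) that, of n]
          unfolding T_def K_def of_nat_mult[symmetric] of_nat_le_iff by auto
        have "0 < real (Suc n)"
          by simp
        note T0 = less_le_trans[OF this T(1)]
        have "transition (\<lambda>y b. (imbalance y b)\<^sup>2) (Y n \<omega>) (B n \<omega>)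
            \<le> ?w \<omega> - c * (?w \<omega> / T) + d / T\<^sup>2"
          using transition_square_imbalance_le[OF p, of "Y n \<omega>" "B n \<omega>"] T0
          unfolding c_def d_def T_def of_nat_0_less_iff .
        moreover have "c * (?w \<omega> / (K * real (Suc n))) \<le> c * (?w \<omega> / T)"
          using c K T T0 by (intro mult_left_mono divide_left_mono mult_pos_pos) auto
        moreover have "d / T\<^sup>2 \<le> d / (real (Suc n))\<^sup>2"
          using d T by (intro frac_le power_mono) auto
        ultimately show ?thesis
          by (simp add: divide_inverse mult_ac)
      qed
      show "AE \<omega> in M. transition (\<lambda>y b. (imbalance y b)\<^sup>2) (Y n \<omega>) (B n \<omega>)
          \<le> ?w \<omega> - c / K / real (Suc n) * ?w \<omega> + ?r"
        by (intro AE_I2 le)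
      have "0 \<le> transition (\<lambda>y b. (imbalance y b)\<^sup>2) y b" for y b
        using p unfolding transition_def Let_def
        by (intro add_nonneg_nonneg mult_nonneg_nonneg) (auto simp: divide_le_eq_1)
      then show "AE \<omega> in M. 0 \<le> ?w \<omega> - c / K / real (Suc n) * ?w \<omega> + ?r"
        by (intro AE_I2 order_trans[OF _ le])
    qed
    also have "\<dots> = a n - c / K * (a n / real (Suc n)) + ?r"
      using int by (simp add: a_def prob_space)
    finally show ?thesis .
  qed
  let ?q = "\<lambda>n. inverse (real (Suc n) ^ 2)"
  have q: "summable ?q"
    using inverse_power_summable[of 2, where 'a = real]
    by (subst summable_Suc_iff[where f = "\<lambda>n. inverse (real n ^ 2)"]) simp
  \<comment> \<open>The term \<open>- a n\<close> carries the telescoping induction and is then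
    dropped by nonnegativity.\<close>
  have "c / K * (\<Sum>k<n. a k / real (Suc k)) \<le> a 0 - a n + d * (\<Sum>k<n. ?q k)" for n
  proof (induction n)
    case (Suc n)
    then show ?case
      using step[of n] by (simp add: distrib_left del: of_nat_Suc)
  qed simp
  also have "a 0 - a n + d * (\<Sum>k<n. ?q k) \<le> a 0 + d * (\<Sum>k. ?q k)" for n
    using nonneg[of n] sum_le_suminf[OF q, of "{..<n}"] d
    by (intro add_mono mult_left_mono) auto
  finally have bound: "c / K * (\<Sum>k<n. a k / real (Suc k)) \<le> a 0 + d * (\<Sum>k. ?q k)" for n .
  have "summable (\<lambda>k. a k / real (Suc k))"
  proof (rule bounded_imp_summable)
    show "a k / real (Suc k) \<ge> 0" for k
      using nonneg[of k] by simp
    show "(\<Sum>k\<le>n. a k / real (Suc k)) \<le> (a 0 + d * (\<Sum>k. ?q k)) / (c / K)" for n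
      using bound[of "Suc n"] c K
      by (subst pos_le_divide_eq) (auto simp: lessThan_Suc_atMost mult.commute simp del: of_nat_Suc)
  qed
  then show ?thesis
    unfolding a_def .
qed

text \<open>Sum and integral commute for nonnegative terms, so the random series has finite
  expectation and converges almost surely; the deterministic criterion then applies path by
  path.\<close>

lemma AE_imbalance_tendsto_0:
  assumes pos: "y0 > 0" "\<alpha> > 0" "\<beta> > 0" "\<gamma> > 0" and p: "0 < p" "p \<le> 1"
  shows "AE \<omega> in M. (\<lambda>n. imbalance (Y n \<omega>) (B n \<omega>)) \<longlonglongrightarrow> 0"
proof -
  let ?v = "\<lambda>n \<omega>. (imbalance (Y n \<omega>) (B n \<omega>))\<^sup>2 / real (Suc n)"
  have int: "integrable M (?v n)" for n
    by (intro integrable_divide integrable_bounded_urn[where C = 1])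
      (simp add: abs_imbalance_le_1 abs_square_le_1)
  then have meas: "?v n \<in> borel_measurable M" for n
    by (rule borel_measurable_integrable)
  note [measurable] = meas
  have "(\<integral>\<^sup>+\<omega>. (\<Sum>n. ennreal (?v n \<omega>)) \<partial>M) = (\<Sum>n. \<integral>\<^sup>+\<omega>. ennreal (?v n \<omega>) \<partial>M)"
    by (rule nn_integral_suminf) measurable
  also have "\<dots> = (\<Sum>n. ennreal (expectation (?v n)))"
    using int by (intro suminf_cong nn_integral_eq_integral) auto
  also have "\<dots> \<noteq> \<infinity>"
    using summable_expectation_square_imbalance[OF assms]
    by (simp add: ennreal_suminf_neq_top del: of_nat_Suc)
  finally have "AE \<omega> in M. (\<Sum>n. ennreal (?v n \<omega>)) \<noteq> \<infinity>"
    by (intro nn_integral_PInf_AE) measurable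
  then show ?thesis
    using AE_space
  proof eventually_elim
    case (elim \<omega>)
    have "summable (\<lambda>n. ?v n \<omega>)"
      using elim(1) by (intro summable_suminf_not_top) auto
    then show ?case
      by (rule tendsto_zero_if_summable_square_over_Suc[rotated])
        (rule imbalance_step[OF pos(1,2,4) elim(2)])
  qed
qed

end

theorem theorem1:
  fixes M :: "'a measure"
    and y0 b0 \<alpha> \<beta> \<gamma> :: nat
    and p :: real
    and Y B \<zeta> \<xi> :: "nat \<Rightarrow> 'a \<Rightarrow> nat"
  assumes "y0 > 0" "b0 > 0" "\<alpha> > 0" "\<beta> > 0" "\<gamma> > 0"
    and "0 < p" "p \<le> 1"
    and "friedman_polya_urn M y0 b0 \<alpha> \<beta> \<gamma> p Y B \<zeta> \<xi>"
  shows "AE \<omega> in M. (\<lambda>n. proportion Y B n \<omega>) \<longlonglongrightarrow> 1 / 2"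
proof -
  interpret friedman_polya_urn M y0 b0 \<alpha> \<beta> \<gamma> p Y B \<zeta> \<xi>
    by fact
  have "AE \<omega> in M. (\<lambda>n. imbalance (Y n \<omega>) (B n \<omega>)) \<longlonglongrightarrow> 0"
    using assms by (intro AE_imbalance_tendsto_0)
  then show ?thesis
    using AE_space
  proof eventually_elim
    case (elim \<omega>)
    \<comment> \<open>The identity fails for an empty urn, where both quotients are 0; the lower
      bound on the total excludes this.\<close>
    have "proportion Y B n \<omega> = (1 + imbalance (Y n \<omega>) (B n \<omega>)) / 2" for n
      using total_bounds(1)[OF assms(1,3,5) elim(2), of n]
      by (simp add: proportion_def imbalance_def field_simps)
    moreover have "(\<lambda>n. (1 + imbalance (Y n \<omega>) (B n \<omega>)) / 2) \<longlonglongrightarrow> (1 + 0) / 2"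
      using elim(1) by (intro tendsto_intros) auto
    ultimately show ?case
      by (simp only: add_0_right)
  qed
qed

end
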